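(* Let $\mathcal{B}$ be a $C^*$-algebra, let $E^\odot=(E_t)_{t\in\mathbb{R}_+}$ be a product system of correspondences over $\mathcal{B}$, and let $i_t\colon E_t\rightarrow E^i$ $(t\in\mathbb{R}_+)$ and $k_t\colon E_t\rightarrow E^k$ $(t\in\mathbb{R}_+)$ be two continuous structures on $E^\odot$. If the identity morphism is a continuous morphism from $E^\odot$ with respect to the embeddings $i$ to $E^\odot$ with respect to the embeddings $k$ (that is, $CS_i(E^\odot)\subset CS_k(E^\odot)$), then the identity morphism is a continuous isomorphism (that is, $CS_i(E^\odot)=CS_k(E^\odot)$).
   Context: $\mathbb{R}_+=[0,\infty)$. A correspondence over $\mathcal{B}$ is a (right) Hilbert $\mathcal{B}$-module with a nondegenerate left action of $\mathcal{B}$ by adjointable operators; $\odot$ is the internal tensor product over $\mathcal{B}$. A product system is a family $E^\odot=(E_t)_{t\in\mathbb{R}_+}$ of correspondences over $\mathcal{B}$ with bilinear unitaries $u_{s,t}\colon E_s\odot E_t\to E_{s+t}$ such that the product $x_sy_t:=u_{s,t}(x_s\odot y_t)$ is associative, $E_0=\mathcal{B}$, and $u_{s,0}$, $u_{0,t}$ are the canonical identifications (right, respectively left, multiplication by elements of $\mathcal{B}$). A morphism $w^\odot\colon E^\odot\to F^\odot$ of product systems is a family of bilinear adjointable maps $w_t\colon E_t\to F_t$ with $(w_sx_s)(w_ty_t)=w_{s+t}(x_sy_t)$ and $w_0=\mathrm{id}_{\mathcal{B}}$; an isomorphism is a morphism consisting of unitaries. A continuous structure on $E^\odot$ is a family of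 isometric (inner product preserving, right $\mathcal{B}$-linear) embeddings $i_t\colon E_t\to\widehat{E}$ into a right Hilbert $\mathcal{B}$-module $\widehat{E}$ such that, with the set of continuous sections $$CS_i(E^\odot)=\{(x_t)_{t\in\mathbb{R}_+}\colon x_t\in E_t,\ t\mapsto i_tx_t \text{ is continuous}\},$$ (1) $\{x_s\colon (x_t)_{t\in\mathbb{R}_+}\in CS_i(E^\odot)\}=E_s$ for all $s\in\mathbb{R}_+$, and (2) $(s,t)\mapsto i_{s+t}(x_sy_t)$ is continuous for all $(x_t),(y_t)\in CS_i(E^\odot)$. A product system with a continuous structure is a continuous product system. A morphism between continuous product systems is continuous if it sends continuous sections to continuous sections. A (continuous) isomorphism of continuous product systems is an isomorphism of product systems that is continuous and has continuous inverse. *)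

theory Defs
  imports "HOL-Analysis.Analysis" "HOL-Algebra.Algebraic_Closure_Type"
begin

section \<open>C*-algebras\<close>

text \<open>Not necessarily unital. Completeness and submultiplicativity of the norm come from the
  library classes; only complex scalars and involution are new.\<close>

class cstar_algebra = real_normed_algebra + banach +
  fixes scaleC :: "complex \<Rightarrow> 'a \<Rightarrow> 'a" (infixr \<open>*\<^sub>C\<close> 75)
    and star :: "'a \<Rightarrow> 'a"
  assumes scaleC_of_real: "complex_of_real r *\<^sub>C a = r *\<^sub>R a"
    and scaleC_add_right: "z *\<^sub>C (a + b) = z *\<^sub>C a + z *\<^sub>C b"
    and scaleC_add_left: "(z + w) *\<^sub>C a = z *\<^sub>C a + w *\<^sub>C a"
    and scaleC_scaleC: "z *\<^sub>C w *\<^sub>C a = (z * w) *\<^sub>C a"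
    and scaleC_mult_left: "(z *\<^sub>C a) * b = z *\<^sub>C (a * b)"
    and scaleC_mult_right: "a * (z *\<^sub>C b) = z *\<^sub>C (a * b)"
    and norm_scaleC: "norm (z *\<^sub>C a) = cmod z * norm a"
    and star_star: "star (star a) = a"
    and star_add: "star (a + b) = star a + star b"
    and star_scaleC: "star (z *\<^sub>C a) = cnj z *\<^sub>C star a"
    and star_mult: "star (a * b) = star b * star a"
    and cstar_identity: "norm (star a * a) = (norm a)\<^sup>2"

definition cstar_positive :: "'b::cstar_algebra \<Rightarrow> bool" where
  "cstar_positive b \<longleftrightarrow> (\<exists>c. b = star c * c)"


section \<open>Hilbert modules and correspondences\<close>

text \<open>Fibres of a product system vary with a real parameter, so modules have explicit carriers.
  The record extends the module record of HOL-Algebra, whose ring fields \<open>mult\<close> and \<open>one\<close> carry no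
  meaning for modules; the scalar multiplication \<open>smult\<close> is by complex numbers.\<close>

record ('b, 'm) hilbert_mod = "(complex, 'm) module" +
  ract :: "'m \<Rightarrow> 'b \<Rightarrow> 'm"
  ip :: "'m \<Rightarrow> 'm \<Rightarrow> 'b"

record ('b, 'm) corr = "('b, 'm) hilbert_mod" +
  lact :: "'b \<Rightarrow> 'm \<Rightarrow> 'm"

text \<open>The value \<open>0\<close> outside the carrier is needed because \<open>Metric_space\<close> demands
  symmetry on the whole type.\<close>

definition mod_dist ::
    "('b::cstar_algebra, 'm, 'z) hilbert_mod_scheme \<Rightarrow> 'm \<Rightarrow> 'm \<Rightarrow> real" where
  "mod_dist M x y = (if x \<in> carrier M \<and> y \<in> carrier M
     then sqrt (norm (ip M (x \<ominus>\<^bsub>M\<^esub> y) (x \<ominus>\<^bsub>M\<^esub> y))) else 0)"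

definition mod_topology ::
    "('b::cstar_algebra, 'm, 'z) hilbert_mod_scheme \<Rightarrow> 'm topology" where
  "mod_topology M = Metric_space.mtopology (carrier M) (mod_dist M)"

definition mod_span ::
    "('b::cstar_algebra, 'm, 'z) hilbert_mod_scheme \<Rightarrow> 'm set \<Rightarrow> 'm set" where
  "mod_span M S = \<Inter> {N. submodule N (ring_of_type_algebra :: complex ring) M \<and> S \<subseteq> N}"

definition mod_total ::
    "('b::cstar_algebra, 'm, 'z) hilbert_mod_scheme \<Rightarrow> 'm set \<Rightarrow> bool" where
  "mod_total M S \<longleftrightarrow> mod_topology M closure_of mod_span M S = carrier M"

text \<open>The inner product is linear in its second argument. That the norm
  \<open>\<parallel>\<langle>x, x\<rangle>\<parallel>\<^sup>\<onehalf>\<close> induces a metric follows from the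
  preceding axioms by the Cauchy-Schwarz inequality; it is listed since \<open>mcomplete\<close> presupposes it.\<close>

locale hilbert_module =
  fixes M :: "('b::cstar_algebra, 'm, 'z) hilbert_mod_scheme" (structure)
  assumes complex_module: "Module.module (ring_of_type_algebra :: complex ring) M"
    and ract_closed: "x \<in> carrier M \<Longrightarrow> ract M x b \<in> carrier M"
    and ract_add_left: "\<lbrakk>x \<in> carrier M; y \<in> carrier M\<rbrakk> \<Longrightarrow>
          ract M (x \<oplus> y) b = ract M x b \<oplus> ract M y b"
    and ract_add_right: "x \<in> carrier M \<Longrightarrow> ract M x (b + c) = ract M x b \<oplus> ract M x c"
    and ract_mult: "x \<in> carrier M \<Longrightarrow> ract M x (b * c) = ract M (ract M x b) c"
    and ract_smult_left: "x \<in> carrier M \<Longrightarrow> ract M (z \<odot> x) b = z \<odot> ract M x b"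
    and ract_smult_right: "x \<in> carrier M \<Longrightarrow> ract M x (z *\<^sub>C b) = z \<odot> ract M x b"
    and ip_add_right: "\<lbrakk>x \<in> carrier M; y \<in> carrier M; y' \<in> carrier M\<rbrakk> \<Longrightarrow>
          ip M x (y \<oplus> y') = ip M x y + ip M x y'"
    and ip_smult_right: "\<lbrakk>x \<in> carrier M; y \<in> carrier M\<rbrakk> \<Longrightarrow> ip M x (z \<odot> y) = z *\<^sub>C ip M x y"
    and ip_ract_right: "\<lbrakk>x \<in> carrier M; y \<in> carrier M\<rbrakk> \<Longrightarrow> ip M x (ract M y b) = ip M x y * b"
    and ip_star: "\<lbrakk>x \<in> carrier M; y \<in> carrier M\<rbrakk> \<Longrightarrow> star (ip M x y) = ip M y x"
    and ip_positive: "x \<in> carrier M \<Longrightarrow> cstar_positive (ip M x x)"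
    and ip_definite: "\<lbrakk>x \<in> carrier M; ip M x x = 0\<rbrakk> \<Longrightarrow> x = \<zero>"
    and metric: "Metric_space (carrier M) (mod_dist M)"
    and complete: "Metric_space.mcomplete (carrier M) (mod_dist M)"

text \<open>The left action is a nondegenerate *-homomorphism into the adjointable operators:
  \<open>lact_adjoint\<close> says that \<open>a\<close> acts with adjoint \<open>star a\<close>.\<close>

locale correspondence = hilbert_module M
  for M :: "('b::cstar_algebra, 'm, 'z) corr_scheme" (structure) +
  assumes lact_closed: "x \<in> carrier M \<Longrightarrow> lact M a x \<in> carrier M"
    and lact_add_left: "x \<in> carrier M \<Longrightarrow> lact M (a + b) x = lact M a x \<oplus> lact M b x"
    and lact_smult_left: "x \<in> carrier M \<Longrightarrow> lact M (z *\<^sub>C a) x = z \<odot> lact M a x"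
    and lact_mult: "x \<in> carrier M \<Longrightarrow> lact M (a * b) x = lact M a (lact M b x)"
    and lact_adjoint: "\<lbrakk>x \<in> carrier M; y \<in> carrier M\<rbrakk> \<Longrightarrow>
          ip M (lact M a x) y = ip M x (lact M (star a) y)"
    and nondegenerate: "mod_total M {lact M a x |a x. x \<in> carrier M}"

text \<open>The C*-algebra as correspondence over itself (\<open>one\<close> is one of the meaningless fields).\<close>

definition self_corr :: "('b::cstar_algebra, 'b) corr" where
  "self_corr = \<lparr>carrier = UNIV, mult = (*), one = undefined, zero = 0, add = (+),
     smult = scaleC, ract = (*), ip = (\<lambda>a b. star a * b), lact = (*)\<rparr>"


section \<open>Maps between modules\<close>

definition right_linear :: "('b::cstar_algebra, 'm, 'y) hilbert_mod_scheme \<Rightarrow>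
    ('b, 'n, 'z) hilbert_mod_scheme \<Rightarrow> ('m \<Rightarrow> 'n) \<Rightarrow> bool" where
  "right_linear M N w \<longleftrightarrow> w \<in> carrier M \<rightarrow> carrier N \<and>
     (\<forall>x\<in>carrier M. \<forall>y\<in>carrier M. w (x \<oplus>\<^bsub>M\<^esub> y) = w x \<oplus>\<^bsub>N\<^esub> w y) \<and>
     (\<forall>x\<in>carrier M. \<forall>z. w (z \<odot>\<^bsub>M\<^esub> x) = z \<odot>\<^bsub>N\<^esub> w x) \<and>
     (\<forall>x\<in>carrier M. \<forall>b. w (ract M x b) = ract N (w x) b)"

definition bilinear_map :: "('b::cstar_algebra, 'm, 'y) corr_scheme \<Rightarrow>
    ('b, 'n, 'z) corr_scheme \<Rightarrow> ('m \<Rightarrow> 'n) \<Rightarrow> bool" where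
  "bilinear_map M N w \<longleftrightarrow> right_linear M N w \<and>
     (\<forall>x\<in>carrier M. \<forall>a. w (lact M a x) = lact N a (w x))"

definition adjointable :: "('b::cstar_algebra, 'm, 'y) hilbert_mod_scheme \<Rightarrow>
    ('b, 'n, 'z) hilbert_mod_scheme \<Rightarrow> ('m \<Rightarrow> 'n) \<Rightarrow> bool" where
  "adjointable M N w \<longleftrightarrow> w \<in> carrier M \<rightarrow> carrier N \<and>
     (\<exists>v \<in> carrier N \<rightarrow> carrier M. \<forall>x\<in>carrier M. \<forall>y\<in>carrier N. ip N (w x) y = ip M x (v y))"

definition isometric :: "('b::cstar_algebra, 'm, 'y) hilbert_mod_scheme \<Rightarrow>
    ('b, 'n, 'z) hilbert_mod_scheme \<Rightarrow> ('m \<Rightarrow> 'n) \<Rightarrow> bool" where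
  "isometric M N w \<longleftrightarrow> right_linear M N w \<and>
     (\<forall>x\<in>carrier M. \<forall>y\<in>carrier M. ip N (w x) (w y) = ip M x y)"

definition unitary_map :: "('b::cstar_algebra, 'm, 'y) hilbert_mod_scheme \<Rightarrow>
    ('b, 'n, 'z) hilbert_mod_scheme \<Rightarrow> ('m \<Rightarrow> 'n) \<Rightarrow> bool" where
  "unitary_map M N w \<longleftrightarrow> isometric M N w \<and> w ` carrier M = carrier N"


section \<open>Internal tensor product\<close>

text \<open>\<open>T\<close> is (a realization of) the internal tensor product of \<open>M\<close> and \<open>N\<close>: the correspondence
  generated by elementary tensors \<open>\<tau> x y\<close> with the usual inner product and actions. These
  properties determine \<open>(T, \<tau>)\<close> up to unique bilinear unitary, and biadditivity and
  balancedness of \<open>\<tau>\<close> follow from the inner product formula.\<close>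

locale internal_tensor_product =
  M: correspondence M + N: correspondence N + T: correspondence T
  for M :: "('b::cstar_algebra, 'm) corr" and N :: "('b, 'n) corr" and T :: "('b, 't) corr" +
  fixes \<tau> :: "'m \<Rightarrow> 'n \<Rightarrow> 't"
  assumes tensor_closed: "\<lbrakk>x \<in> carrier M; y \<in> carrier N\<rbrakk> \<Longrightarrow> \<tau> x y \<in> carrier T"
    and ip_tensor:
      "\<lbrakk>x \<in> carrier M; y \<in> carrier N; x' \<in> carrier M; y' \<in> carrier N\<rbrakk> \<Longrightarrow>
         ip T (\<tau> x y) (\<tau> x' y') = ip N y (lact N (ip M x x') y')"
    and lact_tensor: "\<lbrakk>x \<in> carrier M; y \<in> carrier N\<rbrakk> \<Longrightarrow> lact T a (\<tau> x y) = \<tau> (lact M a x) y"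
    and ract_tensor: "\<lbrakk>x \<in> carrier M; y \<in> carrier N\<rbrakk> \<Longrightarrow> ract T (\<tau> x y) b = \<tau> x (ract N y b)"
    and total_tensor: "mod_total T {\<tau> x y |x y. x \<in> carrier M \<and> y \<in> carrier N}"


section \<open>Product systems\<close>

text \<open>The data of a product system: the fibres \<open>E\<^sub>t\<close>, the identification of
  the C*-algebra with \<open>E\<^sub>0\<close> (the two live in different types), the tensor
  products \<open>E\<^sub>s \<odot> E\<^sub>t\<close> with their elementary tensors, and the maps
  \<open>u\<^sub>s\<^sub>,\<^sub>t\<close>. Values at negative parameters are irrelevant.\<close>

record ('b, 'e, 't) psys =
  fib :: "real \<Rightarrow> ('b, 'e) corr"
  unit_id :: "'b \<Rightarrow> 'e"
  tens :: "real \<Rightarrow> real \<Rightarrow> ('b, 't) corr"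
  elem :: "real \<Rightarrow> real \<Rightarrow> 'e \<Rightarrow> 'e \<Rightarrow> 't"
  umap :: "real \<Rightarrow> real \<Rightarrow> 't \<Rightarrow> 'e"

definition ps_prod :: "('b, 'e, 't) psys \<Rightarrow> real \<Rightarrow> real \<Rightarrow> 'e \<Rightarrow> 'e \<Rightarrow> 'e" where
  "ps_prod P s t x y = umap P s t (elem P s t x y)"

locale product_system =
  fixes P :: "('b::cstar_algebra, 'e, 't) psys"
  assumes fib_correspondence: "t \<ge> 0 \<Longrightarrow> correspondence (fib P t)"
    and tensor: "\<lbrakk>s \<ge> 0; t \<ge> 0\<rbrakk> \<Longrightarrow>
          internal_tensor_product (fib P s) (fib P t) (tens P s t) (elem P s t)"
    and umap_bilinear: "\<lbrakk>s \<ge> 0; t \<ge> 0\<rbrakk> \<Longrightarrow> bilinear_map (tens P s t) (fib P (s + t)) (umap P s t)"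
    and umap_unitary: "\<lbrakk>s \<ge> 0; t \<ge> 0\<rbrakk> \<Longrightarrow> unitary_map (tens P s t) (fib P (s + t)) (umap P s t)"
    and assoc: "\<lbrakk>r \<ge> 0; s \<ge> 0; t \<ge> 0; x \<in> carrier (fib P r); y \<in> carrier (fib P s);
            z \<in> carrier (fib P t)\<rbrakk> \<Longrightarrow>
          ps_prod P (r + s) t (ps_prod P r s x y) z = ps_prod P r (s + t) x (ps_prod P s t y z)"
    and unit_bilinear: "bilinear_map self_corr (fib P 0) (unit_id P)"
    and unit_unitary: "unitary_map self_corr (fib P 0) (unit_id P)"
    and prod_unit_right: "\<lbrakk>s \<ge> 0; x \<in> carrier (fib P s)\<rbrakk> \<Longrightarrow>
          ps_prod P s 0 x (unit_id P b) = ract (fib P s) x b"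
    and prod_unit_left: "\<lbrakk>t \<ge> 0; y \<in> carrier (fib P t)\<rbrakk> \<Longrightarrow>
          ps_prod P 0 t (unit_id P b) y = lact (fib P t) b y"

definition ps_morphism :: "('b::cstar_algebra, 'e, 't) psys \<Rightarrow> ('b, 'f, 'u) psys \<Rightarrow>
    (real \<Rightarrow> 'e \<Rightarrow> 'f) \<Rightarrow> bool" where
  "ps_morphism P Q w \<longleftrightarrow>
     (\<forall>t\<ge>0. bilinear_map (fib P t) (fib Q t) (w t) \<and> adjointable (fib P t) (fib Q t) (w t)) \<and>
     (\<forall>s\<ge>0. \<forall>t\<ge>0. \<forall>x\<in>carrier (fib P s). \<forall>y\<in>carrier (fib P t).
        ps_prod Q s t (w s x) (w t y) = w (s + t) (ps_prod P s t x y)) \<and>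
     (\<forall>b. w 0 (unit_id P b) = unit_id Q b)"

definition ps_isomorphism :: "('b::cstar_algebra, 'e, 't) psys \<Rightarrow> ('b, 'f, 'u) psys \<Rightarrow>
    (real \<Rightarrow> 'e \<Rightarrow> 'f) \<Rightarrow> bool" where
  "ps_isomorphism P Q w \<longleftrightarrow>
     ps_morphism P Q w \<and> (\<forall>t\<ge>0. unitary_map (fib P t) (fib Q t) (w t))"


section \<open>Continuous structures\<close>

definition cont_sections :: "('b::cstar_algebra, 'e, 't) psys \<Rightarrow> ('b, 'h) hilbert_mod \<Rightarrow>
    (real \<Rightarrow> 'e \<Rightarrow> 'h) \<Rightarrow> (real \<Rightarrow> 'e) set" where
  "cont_sections P H i = {x \<in> (\<Pi>\<^sub>E t\<in>{0..}. carrier (fib P t)).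
     continuous_map (top_of_set {0..}) (mod_topology H) (\<lambda>t. i t (x t))}"

definition continuous_structure :: "('b::cstar_algebra, 'e, 't) psys \<Rightarrow>
    ('b, 'h) hilbert_mod \<Rightarrow> (real \<Rightarrow> 'e \<Rightarrow> 'h) \<Rightarrow> bool" where
  "continuous_structure P H i \<longleftrightarrow>
     hilbert_module H \<and>
     (\<forall>t\<ge>0. isometric (fib P t) H (i t)) \<and>
     (\<forall>s\<ge>0. {x s |x. x \<in> cont_sections P H i} = carrier (fib P s)) \<and>
     (\<forall>x \<in> cont_sections P H i. \<forall>y \<in> cont_sections P H i.
        continuous_map (top_of_set ({0..} \<times> {0..})) (mod_topology H)
          (\<lambda>(s, t). i (s + t) (ps_prod P s t (x s) (y t))))"

definition preserves_cont_sections :: "('b::cstar_algebra, 'e, 't) psys \<Rightarrow>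
    ('b, 'h) hilbert_mod \<Rightarrow> (real \<Rightarrow> 'e \<Rightarrow> 'h) \<Rightarrow>
    ('b, 'f, 'u) psys \<Rightarrow> ('b, 'l) hilbert_mod \<Rightarrow> (real \<Rightarrow> 'f \<Rightarrow> 'l) \<Rightarrow>
    (real \<Rightarrow> 'e \<Rightarrow> 'f) \<Rightarrow> bool" where
  "preserves_cont_sections P H i Q L k w \<longleftrightarrow>
     (\<forall>x \<in> cont_sections P H i. (\<lambda>t\<in>{0..}. w t (x t)) \<in> cont_sections Q L k)"

definition continuous_morphism :: "('b::cstar_algebra, 'e, 't) psys \<Rightarrow>
    ('b, 'h) hilbert_mod \<Rightarrow> (real \<Rightarrow> 'e \<Rightarrow> 'h) \<Rightarrow>
    ('b, 'f, 'u) psys \<Rightarrow> ('b, 'l) hilbert_mod \<Rightarrow> (real \<Rightarrow> 'f \<Rightarrow> 'l) \<Rightarrow>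
    (real \<Rightarrow> 'e \<Rightarrow> 'f) \<Rightarrow> bool" where
  "continuous_morphism P H i Q L k w \<longleftrightarrow>
     ps_morphism P Q w \<and> preserves_cont_sections P H i Q L k w"

definition continuous_isomorphism :: "('b::cstar_algebra, 'e, 't) psys \<Rightarrow>
    ('b, 'h) hilbert_mod \<Rightarrow> (real \<Rightarrow> 'e \<Rightarrow> 'h) \<Rightarrow>
    ('b, 'f, 'u) psys \<Rightarrow> ('b, 'l) hilbert_mod \<Rightarrow> (real \<Rightarrow> 'f \<Rightarrow> 'l) \<Rightarrow>
    (real \<Rightarrow> 'e \<Rightarrow> 'f) \<Rightarrow> bool" where
  "continuous_isomorphism P H i Q L k w \<longleftrightarrow>
     ps_isomorphism P Q w \<and> continuous_morphism P H i Q L k w \<and>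
     continuous_morphism Q L k P H i (\<lambda>t. inv_into (carrier (fib P t)) (w t))"

end

theory Submission
  imports Defs
begin

text \<open>A continuous section for \<open>k\<close> is compared near a point \<open>a\<close> with a continuous section for \<open>i\<close>
  that has the same value at \<open>a\<close>; the latter is also continuous for \<open>k\<close>. Since \<open>i\<^sub>t\<close> and \<open>k\<^sub>t\<close> are
  isometric, the distance of the two sections in the fibre at \<open>t\<close> can be computed in either ambient
  module, so it tends to \<open>0\<close> as \<open>t\<close> tends to \<open>a\<close>.\<close>

lemma hilbert_module_abelian_group: "hilbert_module M \<Longrightarrow> abelian_group M"
  by (simp add: hilbert_module_def Module.module_def)

lemma right_linear_diff:
  assumes "hilbert_module M" "hilbert_module N" "right_linear M N w"
    and x: "x \<in> carrier M" and y: "y \<in> carrier M"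
  shows "w (x \<ominus>\<^bsub>M\<^esub> y) = w x \<ominus>\<^bsub>N\<^esub> w y"
proof -
  interpret M: abelian_group M by (rule hilbert_module_abelian_group) fact
  interpret N: abelian_group N by (rule hilbert_module_abelian_group) fact
  have closed: "w v \<in> carrier N" if "v \<in> carrier M" for v
    using assms(3) that by (auto simp: right_linear_def)
  \<comment> \<open>\<open>right_linear\<close> speaks of sums only, so the difference is reached by
    applying additivity to (x - y) + y and cancelling \<open>w y\<close> in
    \<open>N\<close>.\<close>
  have "w x = w ((x \<ominus>\<^bsub>M\<^esub> y) \<oplus>\<^bsub>M\<^esub> y)"
    using x y by (simp add: M.minus_eq M.a_assoc M.l_neg)
  also have "\<dots> = w (x \<ominus>\<^bsub>M\<^esub> y) \<oplus>\<^bsub>N\<^esub> w y"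
    using assms(3) x y by (simp add: right_linear_def)
  finally show ?thesis
    using closed x y by (simp add: N.minus_eq N.a_assoc N.r_neg)
qed

text \<open>The distance is built from the inner product of a difference with itself, and an
  isometric map preserves both ingredients. So distances within one fibre may be measured in any
  module that the fibre is embedded in.\<close>

lemma mod_dist_isometric:
  assumes "hilbert_module M" "hilbert_module N" "isometric M N w"
    and "x \<in> carrier M" "y \<in> carrier M"
  shows "mod_dist N (w x) (w y) = mod_dist M x y"
proof -
  interpret M: abelian_group M by (rule hilbert_module_abelian_group) fact
  have "right_linear M N w" using assms(3) by (simp add: isometric_def)
  then have "w x \<in> carrier N" "w y \<in> carrier N" "w x \<ominus>\<^bsub>N\<^esub> w y = w (x \<ominus>\<^bsub>M\<^esub> y)"
    using assms by (auto simp: right_linear_diff right_linear_def)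
  then show ?thesis
    using assms by (simp add: mod_dist_def isometric_def)
qed

lemma isometric_closed: "isometric M N w \<Longrightarrow> x \<in> carrier M \<Longrightarrow> w x \<in> carrier N"
  by (auto simp: isometric_def right_linear_def)

lemma continuous_map_mod_topologyD:
  assumes "hilbert_module H" "continuous_map T (mod_topology H) f" "a \<in> topspace T" "e > 0"
  obtains U where "openin T U" "a \<in> U" "\<And>t. t \<in> U \<Longrightarrow> mod_dist H (f a) (f t) < e"
proof -
  interpret H: Metric_space "carrier H" "mod_dist H"
    using assms(1) by (rule hilbert_module.metric)
  obtain U where "openin T U" "a \<in> U" "\<forall>t\<in>U. f t \<in> H.mball (f a) e"
    using assms(2-4) unfolding mod_topology_def H.continuous_map_to_metric by blast
  then show thesis
    using that[of U] by simp
qed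

lemma continuous_structureD:
  assumes "continuous_structure P H i"
  shows "hilbert_module H"
    and "t \<ge> 0 \<Longrightarrow> isometric (fib P t) H (i t)"
    and "t \<ge> 0 \<Longrightarrow> {x t |x. x \<in> cont_sections P H i} = carrier (fib P t)"
proof -
  note * = assms[unfolded continuous_structure_def]
  show "hilbert_module H" by (rule *[THEN conjunct1])
  show "isometric (fib P t) H (i t)" if "t \<ge> 0"
    using *[THEN conjunct2, THEN conjunct1] that by blast
  show "{x t |x. x \<in> cont_sections P H i} = carrier (fib P t)" if "t \<ge> 0"
    using *[THEN conjunct2, THEN conjunct2, THEN conjunct1] that by blast
qed

lemma cont_sections_subset_reverse:
  assumes fib: "\<And>t. t \<ge> 0 \<Longrightarrow> hilbert_module (fib P t)"
    and Ei: "hilbert_module Ei" and Ek: "hilbert_module Ek"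
    and i: "\<And>t. t \<ge> 0 \<Longrightarrow> isometric (fib P t) Ei (i t)"
    and k: "\<And>t. t \<ge> 0 \<Longrightarrow> isometric (fib P t) Ek (k t)"
    and full: "\<And>s. s \<ge> 0 \<Longrightarrow> carrier (fib P s) \<subseteq> {x s |x. x \<in> cont_sections P Ei i}"
    and sub: "cont_sections P Ei i \<subseteq> cont_sections P Ek k"
  shows "cont_sections P Ek k \<subseteq> cont_sections P Ei i"
proof
  fix y assume y: "y \<in> cont_sections P Ek k"
  let ?X = "top_of_set {0::real..}"
  interpret I: Metric_space "carrier Ei" "mod_dist Ei" using Ei by (rule hilbert_module.metric)
  interpret K: Metric_space "carrier Ek" "mod_dist Ek" using Ek by (rule hilbert_module.metric)
  have yE: "y \<in> (\<Pi>\<^sub>E t\<in>{0..}. carrier (fib P t))"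
    and yk: "continuous_map ?X (mod_topology Ek) (\<lambda>t. k t (y t))"
    using y by (auto simp: cont_sections_def)
  have yc: "y t \<in> carrier (fib P t)" if "t \<ge> 0" for t
    using yE that by (auto simp: PiE_iff)
  have "\<exists>U. openin ?X U \<and> a \<in> U \<and> (\<forall>t\<in>U. i t (y t) \<in> I.mball (i a (y a)) e)"
    if a: "a \<ge> 0" and e: "e > 0" for a e
  proof -
    \<comment> \<open>Such an \<open>x\<close> exists because the sections continuous for
      \<open>i\<close> fill the fibre at \<open>a\<close>. It depends on \<open>a\<close> and need
      not meet \<open>y\<close> anywhere else.\<close>
    obtain x where x: "x \<in> cont_sections P Ei i" and xa: "x a = y a"
      using full[OF a] yc[OF a] by (force simp: subset_iff)
    have xc: "x t \<in> carrier (fib P t)" if "t \<ge> 0" for t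
      using x that by (auto simp: cont_sections_def PiE_iff)
    \<comment> \<open>The inclusion \<open>sub\<close> enters here: \<open>x\<close> is continuous
      in both ambient modules, whereas \<open>y\<close> is so far continuous only in
      \<open>Ek\<close>.\<close>
    have xi: "continuous_map ?X (mod_topology Ei) (\<lambda>t. i t (x t))"
      and xk: "continuous_map ?X (mod_topology Ek) (\<lambda>t. k t (x t))"
      using x sub by (auto simp: cont_sections_def)
    \<comment> \<open>Three variations between \<open>a\<close> and \<open>t\<close> add up to the
      final bound: that of \<open>x\<close> in \<open>Ei\<close>, that of \<open>x\<close> in
      \<open>Ek\<close> and that of \<open>y\<close> in \<open>Ek\<close>.\<close>
    have aX: "a \<in> topspace ?X" and e3: "e / 3 > 0" using a e by auto
    obtain U where U: "openin ?X U" "a \<in> U"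
      and dU: "\<And>t. t \<in> U \<Longrightarrow> mod_dist Ei (i a (x a)) (i t (x t)) < e / 3"
      using continuous_map_mod_topologyD[OF Ei xi aX e3] by blast
    obtain V where V: "openin ?X V" "a \<in> V"
      and dV: "\<And>t. t \<in> V \<Longrightarrow> mod_dist Ek (k a (x a)) (k t (x t)) < e / 3"
      using continuous_map_mod_topologyD[OF Ek xk aX e3] by blast
    obtain W where W: "openin ?X W" "a \<in> W"
      and dW: "\<And>t. t \<in> W \<Longrightarrow> mod_dist Ek (k a (y a)) (k t (y t)) < e / 3"
      using continuous_map_mod_topologyD[OF Ek yk aX e3] by blast
    have "i t (y t) \<in> I.mball (i a (y a)) e" if t: "t \<in> U \<inter> V \<inter> W" for t
    proof -
      have t0: "t \<ge> 0" using t openin_subset[OF U(1)] by auto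
      note ic = isometric_closed[OF i] and kc = isometric_closed[OF k]
      \<comment> \<open>Both sides equal the distance of \<open>x t\<close> and \<open>y t\<close>
        in the fibre at \<open>t\<close>. This moves the estimate to \<open>Ek\<close>, where both
        sections are known to be continuous.\<close>
      have "mod_dist Ei (i t (x t)) (i t (y t)) = mod_dist Ek (k t (x t)) (k t (y t))"
        using t0 by (simp add: mod_dist_isometric[OF fib Ei i] mod_dist_isometric[OF fib Ek k] xc yc)
      \<comment> \<open>The intermediate point is \<open>k a (x a)\<close>, which is also
        \<open>k a (y a)\<close> by the choice of \<open>x\<close>.\<close>
      also have "\<dots> \<le> mod_dist Ek (k t (x t)) (k a (x a)) + mod_dist Ek (k a (y a)) (k t (y t))"
        using K.triangle[of "k t (x t)" "k a (x a)" "k t (y t)"] xa a t0 by (simp add: kc xc yc)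
      also have "\<dots> < e / 3 + e / 3"
        using dV[of t] dW[of t] t by (intro add_strict_mono) (simp_all add: K.commute[of "k t _"])
      finally have "mod_dist Ei (i t (x t)) (i t (y t)) < e / 3 + e / 3" .
      moreover have "mod_dist Ei (i a (y a)) (i t (y t))
          \<le> mod_dist Ei (i a (x a)) (i t (x t)) + mod_dist Ei (i t (x t)) (i t (y t))"
        using I.triangle[of "i a (x a)" "i t (x t)" "i t (y t)"] xa a t0 by (simp add: ic xc yc)
      moreover have "mod_dist Ei (i a (x a)) (i t (x t)) < e / 3"
        using dU t by auto
      ultimately have "mod_dist Ei (i a (y a)) (i t (y t)) < e" by linarith
      then show ?thesis using a t0 by (simp add: ic yc)
    qed
    with U V W show ?thesis by (intro exI[of _ "U \<inter> V \<inter> W"]) auto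
  qed
  then show "y \<in> cont_sections P Ei i"
    using yE by (simp add: cont_sections_def mod_topology_def I.continuous_map_to_metric)
qed

lemma (in product_system) ps_prod_closed:
  assumes "s \<ge> 0" "t \<ge> 0" "x \<in> carrier (fib P s)" "y \<in> carrier (fib P t)"
  shows "ps_prod P s t x y \<in> carrier (fib P (s + t))"
  using internal_tensor_product.tensor_closed[OF tensor, of s t x y] umap_bilinear[of s t] assms
  by (auto simp: ps_prod_def bilinear_map_def right_linear_def)

text \<open>The conditions on a morphism evaluate it only at elements of the fibres, and the fibres
  are closed under all operations involved. This serves to replace the identity by
  \<open>inv_into\<close>, which is controlled only on the carriers.\<close>

lemma (in product_system) ps_morphism_cong:
  assumes "ps_morphism P Q v"
    and eq: "\<And>t x. t \<ge> 0 \<Longrightarrow> x \<in> carrier (fib P t) \<Longrightarrow> w t x = v t x"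
  shows "ps_morphism P Q w"
proof -
  have unit: "unit_id P b \<in> carrier (fib P 0)" for b
    using unit_bilinear by (auto simp: bilinear_map_def right_linear_def self_corr_def)
  have "bilinear_map (fib P t) (fib Q t) (w t) \<and> adjointable (fib P t) (fib Q t) (w t)"
    if t: "t \<ge> 0" for t
  proof -
    interpret correspondence "fib P t" using t by (rule fib_correspondence)
    interpret Module.module "ring_of_type_algebra :: complex ring" "fib P t"
      by (rule complex_module)
    \<comment> \<open>The scalar ring has every complex number in its carrier, so closedness holds
      for all \<open>z\<close>, as \<open>right_linear\<close> demands.\<close>
    have "z \<odot>\<^bsub>fib P t\<^esub> x \<in> carrier (fib P t)" if "x \<in> carrier (fib P t)" for z x
      using that smult_closed[of z x] by (simp add: ring_of_type_algebra_def)
    moreover have "bilinear_map (fib P t) (fib Q t) (v t)" "adjointable (fib P t) (fib Q t) (v t)"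
      using assms(1) t by (auto simp: ps_morphism_def)
    ultimately show ?thesis
      by (simp add: bilinear_map_def right_linear_def adjointable_def Pi_iff eq t
          ract_closed lact_closed)
  qed
  then show ?thesis
    using assms(1) by (simp add: ps_morphism_def eq unit ps_prod_closed)
qed

text \<open>Sections are extensional functions on the nonnegative reals, so the restricted image of
  a section is literally that section. Agreement with the identity on fibres suffices, which covers
  both the identity and its \<open>inv_into\<close>.\<close>

lemma preserves_cont_sections_id_iff:
  assumes "\<And>t x. t \<ge> 0 \<Longrightarrow> x \<in> carrier (fib P t) \<Longrightarrow> w t x = x"
  shows "preserves_cont_sections P H i P L k w \<longleftrightarrow> cont_sections P H i \<subseteq> cont_sections P L k"
proof -
  have "(\<lambda>t\<in>{0..}. w t (x t)) = x" if "x \<in> cont_sections P H i" for x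
    using that assms by (auto simp: cont_sections_def PiE_iff extensional_def)
  then show ?thesis by (auto simp: preserves_cont_sections_def)
qed

theorem theorem2p2:
  fixes P :: "('b::cstar_algebra, 'e, 't) psys"
    and Ei :: "('b, 'h) hilbert_mod" and i :: "real \<Rightarrow> 'e \<Rightarrow> 'h"
    and Ek :: "('b, 'l) hilbert_mod" and k :: "real \<Rightarrow> 'e \<Rightarrow> 'l"
  assumes "product_system P"
    and "continuous_structure P Ei i"
    and "continuous_structure P Ek k"
    and "continuous_morphism P Ei i P Ek k (\<lambda>t x. x)"
  shows "continuous_isomorphism P Ei i P Ek k (\<lambda>t x. x) \<and>
         cont_sections P Ei i = cont_sections P Ek k"
proof -
  interpret product_system P by fact
  let ?id = "\<lambda>t x. x :: 'e"
  let ?inv = "\<lambda>t. inv_into (carrier (fib P t)) (?id t)"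
  have inv: "?inv t x = x" if "x \<in> carrier (fib P t)" for t x
    using inv_into_f_f[of "?id t" "carrier (fib P t)" x] that by (simp add: inj_on_def)
  have mor: "ps_morphism P P ?id" and sub: "cont_sections P Ei i \<subseteq> cont_sections P Ek k"
    using assms(4) by (simp_all add: continuous_morphism_def preserves_cont_sections_id_iff)
  have "cont_sections P Ek k \<subseteq> cont_sections P Ei i"
  proof (rule cont_sections_subset_reverse[OF _ _ _ _ _ _ sub])
    show "hilbert_module (fib P t)" if "t \<ge> 0" for t
      using fib_correspondence[OF that] by (rule correspondence.axioms(1))
    show "carrier (fib P s) \<subseteq> {x s |x. x \<in> cont_sections P Ei i}" if "s \<ge> 0" for s
      using continuous_structureD(3)[OF assms(2) that] by (rule equalityD2)
  qed (fact continuous_structureD[OF assms(2)] continuous_structureD[OF assms(3)])+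
  with sub have eq: "cont_sections P Ei i = cont_sections P Ek k" by blast
  \<comment> \<open>Right linearity is read off from \<open>mor\<close>; preservation of inner
    products and surjectivity are trivial for the identity.\<close>
  have "ps_isomorphism P P ?id"
    using mor by (auto simp: ps_isomorphism_def unitary_map_def isometric_def ps_morphism_def
        bilinear_map_def)
  moreover have "continuous_morphism P Ek k P Ei i ?inv"
    using ps_morphism_cong[OF mor, of ?inv] preserves_cont_sections_id_iff[of P ?inv Ek k Ei i] inv eq
    by (simp add: continuous_morphism_def)
  ultimately show ?thesis
    using assms(4) eq by (simp add: continuous_isomorphism_def)
qed

end
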